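(* Let $\alpha>1$, and let $0<\varepsilon<R$ and $\psi=(\psi_k)_{k\ge1}$ be a local solution family in the sense of the context. Set $\Omega=(-\varepsilon,\varepsilon)^2$, $W^{s}_{\mathrm{loc}}(0)=\{(u_0,\psi_1(u_0)):\ |u_0|<\varepsilon\}$, $h(u,w)=(P_\alpha(u+w),\ w-P_\alpha(u+w))$, $\tilde\Omega=h(\Omega)$, $\tilde W^{s}_{\mathrm{loc}}(0)=h(W^{s}_{\mathrm{loc}}(0))$, and $$\tilde W^{u}_{\mathrm{loc}}(0)=R_1\tilde W^{s}_{\mathrm{loc}}(0),\qquad R_1(x,z)=(z,x).$$ Consider the recursion $(x_{n+1},z_{n+1})=T(x_n,z_n)$, $n\in\mathbb{Z}$, where $T$ is the homeomorphism of $\mathbb{R}^2$ $$T(x,z)=\bigl(z,\ q(z)+2z-x\bigr),\qquad q(x)=P_{1/\alpha}(x)-4x.$$ Then: i) $\tilde W^{u}_{\mathrm{loc}}(0)$ is negatively invariant by $T$, i.e. $T^{-1}(\tilde W^{u}_{\mathrm{loc}}(0))\subset\tilde W^{u}_{\mathrm{loc}}(0)$. ii) If $(x_0,z_0)\in\tilde W^{u}_{\mathrm{loc}}(0)$, then the corresponding solution of the recursion satisfies $\lim_{n\to-\infty}(x_n,z_n)=0$. iii) Every solution of the recursion such that $(x_n,z_n)\in R_1\tilde\Omega$ for all $n\le0$ satisfies $(x_n,z_n)\in\tilde W^{u}_{\mathrm{loc}}(0)$ for all $n\le0$.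
   Context: For $\beta>0$, $P_\beta(x)=x|x|^{\beta-1}$ for $x\neq0$ and $P_\beta(0)=0$; thus $P_{1/\alpha}=P_\alpha^{-1}$. $\ell_\infty(\mathbb{N})$ is the space of bounded real sequences $(u_n)_{n\ge1}$ with the supremum norm, $B_\infty(R)$ its open ball of radius $R$ centered at $0$, and $B(\varepsilon)=(-\varepsilon,\varepsilon)$. For $u_0\in\mathbb{R}$ and $u\in\ell_\infty(\mathbb{N})$ define $g(u_0,u)\in\ell_\infty(\mathbb{N})$ by $(g(u_0,u))_n=u_n-P_\alpha(u_{n+1}+u_n)-P_\alpha(u_n+u_{n-1})$, $n\ge1$. A "local solution family" consists of $0<\varepsilon<R$ and an odd function $\psi=(\psi_k)_{k\ge1}\in C^1(B(\varepsilon),B_\infty(R))$ with the following properties (the paper proves beforehand that such $\varepsilon,R,\psi$ exist): (a) $g(u_0,\psi(u_0))=0$ for all $u_0\in B(\varepsilon)$, and every $(u_0,u)\in B(\varepsilon)\times B_\infty(R)$ with $g(u_0,u)=0$ satisfies $u=\psi(u_0)$; (b) $\psi_1$ is increasing, $|\psi_1(u_0)|<|u_0|$ for $u_0\in B(\varepsilon)\setminus\{0\}$, and $\psi_1(u_0)=P_\alpha(u_0)+O(|u_0|^{2\alpha-1})$ as $u_0\to0$; (c) $\psi_k$ is the $k$-fold composition of $\psi_1$, and $\psi_1=P_\alpha\circ(\mathrm{Id}+\psi_1)\circ\psi_1+P_\alpha\circ(\mathrm{Id}+\psi_1)$; (d) $\lim_{k\to+\infty}\psi_k(u_0)=0$ for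 all $u_0\in B(\varepsilon)$, and for all $C>1$ there is $\varepsilon_C\in(0,\varepsilon]$ such that $|\psi_k(u_0)|\le C^{\frac1{1-\alpha}}(C^{\frac1{\alpha-1}}|u_0|)^{\alpha^k}$ for all $u_0\in B(\varepsilon_C)$, $k\ge1$. *)

theory Defs
  imports "HOL-Analysis.Analysis" "HOL-Library.Landau_Symbols"
begin

definition Pfun :: "real \<Rightarrow> real \<Rightarrow> real" where
  "Pfun \<beta> x = (if x = 0 then 0 else x * \<bar>x\<bar> powr (\<beta> - 1))"

lemma Pfun_altdef: "Pfun \<beta> x = sgn x * \<bar>x\<bar> powr \<beta>"
proof (cases "x = 0")
  case False
  have "\<bar>x\<bar> * \<bar>x\<bar> powr (\<beta> - 1) = \<bar>x\<bar> powr \<beta>"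
    using False by (simp add: powr_diff)
  moreover have "x = sgn x * \<bar>x\<bar>"
    by (simp add: sgn_mult_abs)
  ultimately show ?thesis
    using False by (metis Pfun_def mult.assoc)
qed (simp add: Pfun_def)

lemma Pfun_inverse:
  assumes "\<beta> > 0"
  shows "Pfun (1 / \<beta>) (Pfun \<beta> x) = x" and "Pfun \<beta> (Pfun (1 / \<beta>) x) = x"
  using assms by (auto simp: Pfun_altdef sgn_mult abs_mult powr_powr sgn_if abs_if)

lemma continuous_on_Pfun:
  assumes "\<beta> > 0"
  shows "continuous_on S (Pfun \<beta>)"
proof -
  have eq: "Pfun \<beta> = (\<lambda>x. max x 0 powr \<beta> - max (- x) 0 powr \<beta>)"
    using assms by (auto simp: Pfun_altdef sgn_if abs_if max_def fun_eq_iff)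
  show ?thesis
    unfolding eq using assms by (intro continuous_on_diff continuous_on_powr' continuous_intros) auto
qed

lemma abs_Pfun_le:
  assumes "\<beta> > 0" "\<bar>x\<bar> \<le> M"
  shows "\<bar>Pfun \<beta> x\<bar> \<le> M powr \<beta>"
  using assms by (auto simp: Pfun_altdef abs_mult abs_sgn_eq intro: powr_mono2)

text \<open>
  Bounded sequences indexed by \<open>n \<ge> 1\<close> are rendered by the sup-normed type \<open>nat \<Rightarrow>\<^sub>C real\<close>
  (every function on the discrete space \<open>nat\<close> is continuous), whose index starts at 0.
  Hence the \<open>n\<close>-th term of \<open>u\<close> is stored at position \<open>n - 1\<close>.
\<close>

definition term_of :: "(nat \<Rightarrow>\<^sub>C real) \<Rightarrow> nat \<Rightarrow> real" where
  "term_of u n = apply_bcontfun u (n - 1)"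

definition prepend :: "real \<Rightarrow> (nat \<Rightarrow>\<^sub>C real) \<Rightarrow> nat \<Rightarrow> real" where
  "prepend u\<^sub>0 u n = (if n = 0 then u\<^sub>0 else term_of u n)"

definition g_term :: "real \<Rightarrow> real \<Rightarrow> (nat \<Rightarrow>\<^sub>C real) \<Rightarrow> nat \<Rightarrow> real" where
  "g_term \<alpha> u\<^sub>0 u n =
     (let v = prepend u\<^sub>0 u
      in v n - Pfun \<alpha> (v (n + 1) + v n) - Pfun \<alpha> (v n + v (n - 1)))"

definition g_map :: "real \<Rightarrow> real \<Rightarrow> (nat \<Rightarrow>\<^sub>C real) \<Rightarrow> (nat \<Rightarrow>\<^sub>C real)" where
  "g_map \<alpha> u\<^sub>0 u = Bcontfun (\<lambda>m. g_term \<alpha> u\<^sub>0 u (m + 1))"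

lemma term_of_g_map:
  assumes "\<alpha> > 0" "n \<ge> 1"
  shows "term_of (g_map \<alpha> u\<^sub>0 u) n = g_term \<alpha> u\<^sub>0 u n"
proof -
  define v where "v = prepend u\<^sub>0 u"
  define M where "M = \<bar>u\<^sub>0\<bar> + norm u"
  have v: "\<bar>v k\<bar> \<le> M" for k
    using norm_bounded[of u "k - 1"] by (auto simp: v_def M_def prepend_def term_of_def)
  have P: "\<bar>Pfun \<alpha> (v j + v k)\<bar> \<le> (2 * M) powr \<alpha>" for j k
    using v[of j] v[of k] by (intro abs_Pfun_le assms) linarith
  have "\<bar>g_term \<alpha> u\<^sub>0 u k\<bar> \<le> M + 2 * (2 * M) powr \<alpha>" for k
    using v[of k] P[of "k + 1" k] P[of k "k - 1"]
    unfolding g_term_def Let_def v_def by linarith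
  then have "bounded (range (\<lambda>m. g_term \<alpha> u\<^sub>0 u (m + 1)))"
    by (auto simp: bounded_iff)
  then have "(\<lambda>m. g_term \<alpha> u\<^sub>0 u (m + 1)) \<in> bcontfun"
    by (auto simp: bcontfun_def)
  then show ?thesis
    using assms by (simp add: term_of_def g_map_def Bcontfun_inverse)
qed

locale local_solution_family =
  fixes \<alpha> \<epsilon> R :: real and \<psi> :: "real \<Rightarrow> (nat \<Rightarrow>\<^sub>C real)"
  assumes radii: "0 < \<epsilon>" "\<epsilon> < R"
    and maps_to: "\<forall>t\<in>{-\<epsilon><..<\<epsilon>}. \<psi> t \<in> ball 0 R"
    and C1: "\<psi> C1_differentiable_on {-\<epsilon><..<\<epsilon>}"
    and odd: "\<forall>t\<in>{-\<epsilon><..<\<epsilon>}. \<psi> (- t) = - \<psi> t"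
    and solves: "\<forall>t\<in>{-\<epsilon><..<\<epsilon>}. g_map \<alpha> t (\<psi> t) = 0"
    and unique: "\<forall>t\<in>{-\<epsilon><..<\<epsilon>}. \<forall>u\<in>ball 0 R. g_map \<alpha> t u = 0 \<longrightarrow> u = \<psi> t"
    and psi1_mono: "mono_on {-\<epsilon><..<\<epsilon>} (\<lambda>t. term_of (\<psi> t) 1)"
    and psi1_contracts: "\<forall>t\<in>{-\<epsilon><..<\<epsilon>} - {0}. \<bar>term_of (\<psi> t) 1\<bar> < \<bar>t\<bar>"
    and psi1_expansion:
      "(\<lambda>t. term_of (\<psi> t) 1 - Pfun \<alpha> t) \<in> O[at 0](\<lambda>t. \<bar>t\<bar> powr (2 * \<alpha> - 1))"
    and psi_iterate:
      "\<forall>k\<ge>1. \<forall>t\<in>{-\<epsilon><..<\<epsilon>}. term_of (\<psi> t) k = ((\<lambda>s. term_of (\<psi> s) 1) ^^ k) t"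
    and psi1_functional_eq:
      "\<forall>t\<in>{-\<epsilon><..<\<epsilon>}. let \<psi>\<^sub>1 = (\<lambda>s. term_of (\<psi> s) 1) in
         \<psi>\<^sub>1 t = (Pfun \<alpha> \<circ> (\<lambda>s. s + \<psi>\<^sub>1 s) \<circ> \<psi>\<^sub>1) t + (Pfun \<alpha> \<circ> (\<lambda>s. s + \<psi>\<^sub>1 s)) t"
    and psi_tendsto_0: "\<forall>t\<in>{-\<epsilon><..<\<epsilon>}. (\<lambda>k. term_of (\<psi> t) k) \<longlonglongrightarrow> 0"
    and psi_decay:
      "\<forall>C>1. \<exists>\<epsilon>\<^sub>C. 0 < \<epsilon>\<^sub>C \<and> \<epsilon>\<^sub>C \<le> \<epsilon> \<and>
         (\<forall>t\<in>{-\<epsilon>\<^sub>C<..<\<epsilon>\<^sub>C}. \<forall>k\<ge>1.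
            \<bar>term_of (\<psi> t) k\<bar>
              \<le> C powr (1 / (1 - \<alpha>)) * (C powr (1 / (\<alpha> - 1)) * \<bar>t\<bar>) powr (\<alpha> ^ k))"

definition \<Omega> :: "real \<Rightarrow> (real \<times> real) set" where
  "\<Omega> \<epsilon> = {-\<epsilon><..<\<epsilon>} \<times> {-\<epsilon><..<\<epsilon>}"

definition Ws_loc :: "real \<Rightarrow> (real \<Rightarrow> (nat \<Rightarrow>\<^sub>C real)) \<Rightarrow> (real \<times> real) set" where
  "Ws_loc \<epsilon> \<psi> = {(t, term_of (\<psi> t) 1) | t. \<bar>t\<bar> < \<epsilon>}"

definition h_map :: "real \<Rightarrow> real \<times> real \<Rightarrow> real \<times> real" where
  "h_map \<alpha> = (\<lambda>(u, w). (Pfun \<alpha> (u + w), w - Pfun \<alpha> (u + w)))"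

definition R1 :: "real \<times> real \<Rightarrow> real \<times> real" where
  "R1 = (\<lambda>(x, z). (z, x))"

definition \<Omega>_tilde :: "real \<Rightarrow> real \<Rightarrow> (real \<times> real) set" where
  "\<Omega>_tilde \<alpha> \<epsilon> = h_map \<alpha> ` \<Omega> \<epsilon>"

definition Ws_tilde :: "real \<Rightarrow> real \<Rightarrow> (real \<Rightarrow> (nat \<Rightarrow>\<^sub>C real)) \<Rightarrow> (real \<times> real) set" where
  "Ws_tilde \<alpha> \<epsilon> \<psi> = h_map \<alpha> ` Ws_loc \<epsilon> \<psi>"

definition Wu_tilde :: "real \<Rightarrow> real \<Rightarrow> (real \<Rightarrow> (nat \<Rightarrow>\<^sub>C real)) \<Rightarrow> (real \<times> real) set" where
  "Wu_tilde \<alpha> \<epsilon> \<psi> = R1 ` Ws_tilde \<alpha> \<epsilon> \<psi>"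

definition q_fun :: "real \<Rightarrow> real \<Rightarrow> real" where
  "q_fun \<alpha> x = Pfun (1 / \<alpha>) x - 4 * x"

definition T_map :: "real \<Rightarrow> real \<times> real \<Rightarrow> real \<times> real" where
  "T_map \<alpha> = (\<lambda>(x, z). (z, q_fun \<alpha> z + 2 * z - x))"

definition is_orbit :: "real \<Rightarrow> (int \<Rightarrow> real \<times> real) \<Rightarrow> bool" where
  "is_orbit \<alpha> s \<longleftrightarrow> (\<forall>n. s (n + 1) = T_map \<alpha> (s n))"

lemma bij_T_map: "bij (T_map \<alpha>)"
  by (rule bij_betw_byWitness[where f' = "\<lambda>(a, b). (q_fun \<alpha> a + 2 * a - b, a)"])
     (auto simp: T_map_def)

lemma inv_T_map: "inv (T_map \<alpha>) = (\<lambda>(a, b). (q_fun \<alpha> a + 2 * a - b, a))"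
  by (rule inv_unique_comp) (auto simp: T_map_def fun_eq_iff)

lemma homeomorphism_T_map:
  assumes "\<alpha> > 0"
  shows "homeomorphism UNIV UNIV (T_map \<alpha>) (inv (T_map \<alpha>))"
proof -
  have q: "continuous_on UNIV (\<lambda>x. q_fun \<alpha> (f x))"
    if "continuous_on UNIV f" for f :: "real \<times> real \<Rightarrow> real"
    unfolding q_fun_def using assms that
    by (intro continuous_intros continuous_on_compose2[OF continuous_on_Pfun[of _ UNIV]]) auto
  have "continuous_on UNIV (T_map \<alpha>)"
    unfolding T_map_def case_prod_unfold by (intro continuous_intros q)
  moreover have "continuous_on UNIV (inv (T_map \<alpha>))"
    unfolding inv_T_map case_prod_unfold by (intro continuous_intros q)
  ultimately show ?thesis
    using bij_T_map[of \<alpha>]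
    by (auto simp: homeomorphism_def bij_is_inj bij_is_surj surj_f_inv_f bij_imp_bij_inv)
qed

lemma ex1_orbit: "\<exists>!s. is_orbit \<alpha> s \<and> s 0 = p"
proof (rule ex1I)
  let ?T = "T_map \<alpha>" and ?I = "inv (T_map \<alpha>)"
  define s where "s n = (if n \<ge> 0 then (?T ^^ nat n) p else (?I ^^ nat (- n)) p)" for n :: int
  have TI: "?T (?I y) = y" for y
    by (simp add: bij_T_map bij_is_surj surj_f_inv_f)
  have "s (n + 1) = ?T (s n)" for n
  proof (cases "n \<ge> 0")
    case True
    then show ?thesis by (simp add: s_def nat_add_distrib)
  next
    case False
    then have "nat (- n) = Suc (nat (- (n + 1)))" by simp
    with False have "?T (s n) = (?I ^^ nat (- (n + 1))) p" by (simp add: s_def TI)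
    also have "\<dots> = s (n + 1)"
      using False by (cases "n = -1") (auto simp: s_def)
    finally show ?thesis by simp
  qed
  then show "is_orbit \<alpha> s \<and> s 0 = p" by (simp add: is_orbit_def s_def)
  fix r assume r: "is_orbit \<alpha> r \<and> r 0 = p"
  have "r n = s n" for n
  proof (induction n rule: int_induct[where k = 0])
    case base
    then show ?case using r by (simp add: s_def)
  next
    case (step1 i)
    then show ?case
      using r \<open>\<And>n. s (n + 1) = ?T (s n)\<close> by (simp add: is_orbit_def)
  next
    case (step2 i)
    have "?T (r (i - 1)) = r i" "?T (s (i - 1)) = s i"
      using r \<open>\<And>n. s (n + 1) = ?T (s n)\<close>[of "i - 1"] unfolding is_orbit_def
      by (metis diff_add_cancel, simp)
    then show ?case
      using step2 bij_T_map[of \<alpha>] by (metis bij_is_inj injD)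
  qed
  then show "r = s" by blast
qed

end

theory Submission
  imports Defs
begin

text \<open>
  With \<open>x\<^sub>n = P\<^sub>\<alpha>(u\<^sub>n + u\<^sub>n\<^sub>-\<^sub>1)\<close>, the equation \<open>g(u\<^sub>0, u) = 0\<close> reads \<open>u\<^sub>n = x\<^sub>n + x\<^sub>n\<^sub>+\<^sub>1\<close>, so that
  \<open>h(u\<^sub>n\<^sub>-\<^sub>1, u\<^sub>n) = (x\<^sub>n, x\<^sub>n\<^sub>+\<^sub>1)\<close> and \<open>h\<close> conjugates the recursion for \<open>u\<close> to \<open>T\<close>. The map \<open>T\<close> is
  reversible, \<open>R\<^sub>1 T\<^sup>-\<^sup>1 R\<^sub>1 = T\<close>, so a backward orbit of \<open>T\<close> in \<open>R\<^sub>1 h(\<Omega>)\<close> is the reflection of the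
  image of a small bounded solution \<open>u\<close>, and these are exactly the \<open>\<psi>(u\<^sub>0)\<close>.
\<close>

lemma inv_T_map_R1: "inv (T_map \<alpha>) (R1 p) = R1 (T_map \<alpha> p)"
  unfolding inv_T_map by (cases p) (simp add: R1_def T_map_def)

lemma R1_R1 [simp]: "R1 (R1 p) = p"
  by (cases p) (simp add: R1_def)

text \<open>The hypothesis is one component of \<open>g = 0\<close>. It turns the second coordinate
  \<open>b - Pfun \<alpha> (a + b)\<close> into \<open>Pfun \<alpha> (b + c)\<close>, from which
  \<open>q_fun\<close> recovers \<open>b + c\<close> by inverting
  \<open>Pfun \<alpha>\<close>.\<close>

lemma T_map_h_map:
  assumes "\<alpha> > 0" and "b = Pfun \<alpha> (b + c) + Pfun \<alpha> (a + b)"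
  shows "T_map \<alpha> (h_map \<alpha> (a, b)) = h_map \<alpha> (b, c)"
proof -
  have "b - Pfun \<alpha> (a + b) = Pfun \<alpha> (b + c)"
    using assms(2) by simp
  with assms show ?thesis
    by (simp add: T_map_def h_map_def q_fun_def Pfun_inverse)
qed

text \<open>Converse of the previous lemma for two unrelated pairs. The first coordinates give
  \<open>b - x = y\<close>; inverting \<open>Pfun \<alpha>\<close> in the second ones gives
  \<open>a' = x + y\<close>, hence \<open>a' = b\<close>.\<close>

lemma T_map_h_map_eqD:
  assumes "\<alpha> > 0" and "T_map \<alpha> (h_map \<alpha> (a, b)) = h_map \<alpha> (a', b')"
  shows "a' = b" and "b = Pfun \<alpha> (b + b') + Pfun \<alpha> (a + b)"
proof -
  define x y where "x = Pfun \<alpha> (a + b)" and "y = Pfun \<alpha> (a' + b')"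
  have "b - x = y" and "q_fun \<alpha> y + 2 * y - x = b' - y"
    using assms(2) by (auto simp: T_map_def h_map_def x_def y_def)
  moreover have "q_fun \<alpha> y = a' + b' - 4 * y"
    using assms(1) by (simp add: q_fun_def y_def Pfun_inverse)
  ultimately show "a' = b" by linarith
  with \<open>b - x = y\<close> show "b = Pfun \<alpha> (b + b') + Pfun \<alpha> (a + b)"
    by (simp add: x_def y_def)
qed

lemma continuous_on_h_map:
  assumes "\<alpha> > 0"
  shows "continuous_on S (h_map \<alpha>)"
  unfolding h_map_def case_prod_unfold using assms
  by (intro continuous_intros continuous_on_compose2[OF continuous_on_Pfun[of _ UNIV]]) auto

lemma is_orbit_pred:
  assumes "is_orbit \<alpha> s"
  shows "s (n - 1) = inv (T_map \<alpha>) (s n)"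
proof -
  have "s n = T_map \<alpha> (s (n - 1))"
    using assms by (metis diff_add_cancel is_orbit_def)
  then show ?thesis
    by (simp add: bij_T_map bij_is_inj)
qed

text \<open>By reversibility, the reflected past of an orbit is a forward orbit of
  \<open>T_map\<close>.\<close>

lemma is_orbit_R1_backward:
  assumes "is_orbit \<alpha> s"
  shows "R1 (s (- int (Suc n))) = T_map \<alpha> (R1 (s (- int n)))"
proof -
  have "s (- int (Suc n)) = inv (T_map \<alpha>) (R1 (R1 (s (- int n))))"
    using is_orbit_pred[OF assms, of "- int n"] by (simp add: minus_diff_commute)
  then show ?thesis
    unfolding inv_T_map_R1 by simp
qed

lemma tendsto_at_bot_int:
  fixes s :: "int \<Rightarrow> 'a :: topological_space"
  assumes "(\<lambda>n. s (- int n)) \<longlonglongrightarrow> l"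
  shows "(s \<longlongrightarrow> l) at_bot"
proof (rule topological_tendstoI)
  fix U assume "open U" "l \<in> U"
  with assms obtain N where N: "\<And>n. n \<ge> N \<Longrightarrow> s (- int n) \<in> U"
    by (auto simp: tendsto_def eventually_sequentially)
  have "s k \<in> U" if "k \<le> - int N" for k
    using N[of "nat (- k)"] that by simp
  then show "\<forall>\<^sub>F k in at_bot. s k \<in> U"
    by (auto simp: eventually_at_bot_linorder)
qed

context local_solution_family
begin

definition psi1 :: "real \<Rightarrow> real" where
  "psi1 t = term_of (\<psi> t) 1"

lemma abs_psi1_less:
  assumes "\<bar>t\<bar> < \<epsilon>"
  shows "\<bar>psi1 t\<bar> < \<epsilon>"
proof (cases "t = 0")
  case True
  \<comment> \<open>The strict contraction excludes 0; there oddness forces the value 0.\<close>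
  have "\<psi> 0 = - \<psi> 0"
    using odd[rule_format, of 0] radii by simp
  then have "psi1 0 = - psi1 0"
    unfolding psi1_def term_of_def by (metis uminus_bcontfun.rep_eq)
  then show ?thesis using True assms by simp
next
  case False
  then have "\<bar>psi1 t\<bar> < \<bar>t\<bar>"
    using assms psi1_contracts by (auto simp: psi1_def abs_less_iff)
  then show ?thesis using assms by simp
qed

lemma abs_psi1_funpow_less: "\<bar>t\<bar> < \<epsilon> \<Longrightarrow> \<bar>(psi1 ^^ k) t\<bar> < \<epsilon>"
  by (induction k) (auto intro: abs_psi1_less)

lemma psi1_eq:
  assumes "\<bar>t\<bar> < \<epsilon>"
  shows "psi1 t = Pfun \<alpha> (psi1 t + psi1 (psi1 t)) + Pfun \<alpha> (t + psi1 t)"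
  using psi1_functional_eq assms by (auto simp: psi1_def Let_def abs_less_iff)

lemma psi1_funpow_tendsto_0:
  assumes "\<bar>t\<bar> < \<epsilon>"
  shows "(\<lambda>k. (psi1 ^^ k) t) \<longlonglongrightarrow> 0"
proof (rule Lim_transform_eventually)
  have t: "t \<in> {-\<epsilon><..<\<epsilon>}" using assms by auto
  show "(\<lambda>k. term_of (\<psi> t) k) \<longlonglongrightarrow> 0"
    using psi_tendsto_0 t by blast
  have "psi1 = (\<lambda>s. term_of (\<psi> s) 1)"
    by (simp add: psi1_def fun_eq_iff)
  \<comment> \<open>The two sequences may differ at \<open>k = 0\<close>: since
    \<open>0 - 1 = 0\<close> in the naturals, \<open>term_of\<close> returns \<open>psi1 t\<close>
    there, while the zeroth iterate is \<open>t\<close>.\<close>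
  then show "\<forall>\<^sub>F k in sequentially. term_of (\<psi> t) k = (psi1 ^^ k) t"
    using psi_iterate t by (auto simp: eventually_sequentially intro!: exI[of _ 1])
qed

lemma Wu_tilde_eq: "Wu_tilde \<alpha> \<epsilon> \<psi> = {R1 (h_map \<alpha> (t, psi1 t)) | t. \<bar>t\<bar> < \<epsilon>}"
  by (auto simp: Wu_tilde_def Ws_tilde_def Ws_loc_def psi1_def)

lemma T_map_h_map_psi1:
  assumes "\<alpha> > 0" "\<bar>t\<bar> < \<epsilon>"
  shows "T_map \<alpha> (h_map \<alpha> (t, psi1 t)) = h_map \<alpha> (psi1 t, psi1 (psi1 t))"
  using assms by (intro T_map_h_map psi1_eq)

text \<open>After reflection, the inverse of \<open>T_map\<close> moves the point with parameter
  \<open>t\<close> to the one with parameter \<open>psi1 t\<close>, which stays in the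
  interval.\<close>

lemma Wu_tilde_negatively_invariant:
  assumes "\<alpha> > 0"
  shows "inv (T_map \<alpha>) ` Wu_tilde \<alpha> \<epsilon> \<psi> \<subseteq> Wu_tilde \<alpha> \<epsilon> \<psi>"
  using abs_psi1_less by (auto simp: Wu_tilde_eq inv_T_map_R1 T_map_h_map_psi1 assms)

lemma orbit_Wu_tilde_tendsto_0:
  assumes "\<alpha> > 0" "is_orbit \<alpha> s" "s 0 \<in> Wu_tilde \<alpha> \<epsilon> \<psi>"
  shows "(s \<longlongrightarrow> 0) at_bot"
proof -
  from assms(3) obtain t where t: "\<bar>t\<bar> < \<epsilon>" "s 0 = R1 (h_map \<alpha> (t, psi1 t))"
    by (auto simp: Wu_tilde_eq)
  define u where "u k = (psi1 ^^ k) t" for k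
  \<comment> \<open>Going back one step in time applies \<open>psi1\<close> once more to the
    parameter, so the limit reduces to \<open>u\<close> tending to 0 and continuity of
    \<open>h_map\<close>.\<close>
  have "R1 (s (- int k)) = h_map \<alpha> (u k, u (Suc k))" for k
  proof (induction k)
    case 0
    then show ?case by (simp add: u_def t)
  next
    case (Suc k)
    then show ?case
      using abs_psi1_funpow_less[OF t(1)] assms(1)
      by (simp only: is_orbit_R1_backward[OF assms(2)]) (simp add: u_def T_map_h_map_psi1)
  qed
  then have s: "s (- int k) = R1 (h_map \<alpha> (u k, u (Suc k)))" for k
    by (metis R1_R1)
  have u: "u \<longlonglongrightarrow> 0"
    unfolding u_def by (rule psi1_funpow_tendsto_0[OF t(1)])
  have "(\<lambda>k. h_map \<alpha> (u k, u (Suc k))) \<longlonglongrightarrow> h_map \<alpha> (0, 0)"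
    using continuous_on_h_map[OF assms(1), of UNIV] u
    by (intro continuous_on_tendsto_compose[where f = "h_map \<alpha>" and s = UNIV]
          tendsto_Pair LIMSEQ_Suc) auto
  then have "(\<lambda>k. R1 (h_map \<alpha> (u k, u (Suc k)))) \<longlonglongrightarrow> R1 (h_map \<alpha> (0, 0))"
    unfolding R1_def case_prod_unfold by (intro tendsto_intros)
  moreover have "R1 (h_map \<alpha> (0, 0)) = 0"
    by (simp add: R1_def h_map_def Pfun_def zero_prod_def)
  ultimately show ?thesis
    by (intro tendsto_at_bot_int) (simp add: s)
qed

text \<open>The uniqueness clause, applied to the tail of \<open>u\<close> with \<open>u 0\<close>
  as the prescribed initial value.\<close>

lemma small_solution_eq_psi1:
  assumes less: "\<And>k. \<bar>u k\<bar> < \<epsilon>"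
    and eq: "\<And>k. u (Suc k) = Pfun \<alpha> (u (Suc k) + u (Suc (Suc k))) + Pfun \<alpha> (u k + u (Suc k))"
  shows "u 1 = psi1 (u 0)"
proof -
  define v where "v = Bcontfun (\<lambda>k. u (Suc k))"
  have "(\<lambda>k. u (Suc k)) \<in> bcontfun"
    using less by (auto simp: bcontfun_def bounded_iff intro!: exI[of _ \<epsilon>] less_imp_le)
  then have v: "apply_bcontfun v k = u (Suc k)" for k
    by (simp add: v_def Bcontfun_inverse)
  \<comment> \<open>The supremum of the terms may equal \<epsilon>; the gap \<epsilon> < R still
    puts \<open>v\<close> in the open ball.\<close>
  have "norm v \<le> \<epsilon>"
    using less by (intro norm_bound) (auto simp: v less_imp_le)
  then have "v \<in> ball 0 R"
    using radii by simp
  moreover have pre: "prepend (u 0) v k = u k" for k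
    by (cases k) (auto simp: prepend_def term_of_def v)
  have "g_term \<alpha> (u 0) v (m + 1) = 0" for m
    using eq[of m] by (simp add: g_term_def pre add.commute)
  then have "g_map \<alpha> (u 0) v = 0"
    by (simp add: g_map_def zero_bcontfun_def const_bcontfun_def)
  moreover have "u 0 \<in> {-\<epsilon><..<\<epsilon>}"
    using less[of 0] by auto
  ultimately have "v = \<psi> (u 0)"
    using unique by blast
  then show ?thesis
    using v[of 0] by (simp add: psi1_def term_of_def)
qed

lemma backward_orbit_in_Wu_tilde:
  assumes "\<alpha> > 0" "is_orbit \<alpha> s" "\<forall>n\<le>0. s n \<in> R1 ` \<Omega>_tilde \<alpha> \<epsilon>" "n \<le> 0"
  shows "s n \<in> Wu_tilde \<alpha> \<epsilon> \<psi>"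
proof -
  have "\<exists>p. p \<in> \<Omega> \<epsilon> \<and> R1 (s (- int k)) = h_map \<alpha> p" for k
    using assms(3)[rule_format, of "- int k"] by (fastforce simp: \<Omega>_tilde_def)
  then obtain p where p: "\<And>k. p k \<in> \<Omega> \<epsilon>" "\<And>k. R1 (s (- int k)) = h_map \<alpha> (p k)"
    by metis
  define u where "u k = fst (p k)" for k
  have step: "T_map \<alpha> (h_map \<alpha> (fst (p k), snd (p k))) = h_map \<alpha> (fst (p (Suc k)), snd (p (Suc k)))" for k
    using is_orbit_R1_backward[OF assms(2), of k] by (simp only: p prod.collapse)
  \<comment> \<open>The preimages \<open>p k\<close> were chosen independently, yet the conjugacy
    forces them to chain into a single sequence \<open>u\<close>.\<close>
  have snd_p: "snd (p k) = u (Suc k)" for k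
    using T_map_h_map_eqD(1)[OF assms(1) step[of k]] by (simp add: u_def)
  have eq: "u (Suc k) = Pfun \<alpha> (u (Suc k) + u (Suc (Suc k))) + Pfun \<alpha> (u k + u (Suc k))" for k
    using T_map_h_map_eqD(2)[OF assms(1) step[of k]] by (simp add: snd_p flip: u_def)
  have less: "\<bar>u k\<bar> < \<epsilon>" for k
    using p(1)[of k] by (auto simp: \<Omega>_def u_def)
  define k where "k = nat (- n)"
  \<comment> \<open>Every shift of \<open>u\<close> is again a small solution, so the graph relation
    holds at each index and not only at 0.\<close>
  have "u (k + 1) = psi1 (u (k + 0))"
    by (rule small_solution_eq_psi1[where u = "\<lambda>j. u (k + j)"]) (use less eq in auto)
  then have "p k = (u k, psi1 (u k))"
    by (simp add: prod_eq_iff snd_p u_def[symmetric])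
  then have "s n = R1 (h_map \<alpha> (u k, psi1 (u k)))"
    using p(2)[of k] assms(4) by (metis R1_R1 k_def int_nat_eq minus_minus neg_0_le_iff_le)
  then show ?thesis
    using less by (auto simp: Wu_tilde_eq)
qed

end

theorem theorem5:
  fixes \<alpha> \<epsilon> R :: real and \<psi> :: "real \<Rightarrow> (nat \<Rightarrow>\<^sub>C real)"
  assumes "\<alpha> > 1"
    and "local_solution_family \<alpha> \<epsilon> R \<psi>"
  shows "inv (T_map \<alpha>) ` Wu_tilde \<alpha> \<epsilon> \<psi> \<subseteq> Wu_tilde \<alpha> \<epsilon> \<psi>
    \<and> (\<forall>s. is_orbit \<alpha> s \<and> s 0 \<in> Wu_tilde \<alpha> \<epsilon> \<psi> \<longrightarrow> (s \<longlongrightarrow> 0) at_bot)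
    \<and> (\<forall>s. is_orbit \<alpha> s \<and> (\<forall>n\<le>0. s n \<in> R1 ` \<Omega>_tilde \<alpha> \<epsilon>)
          \<longrightarrow> (\<forall>n\<le>0. s n \<in> Wu_tilde \<alpha> \<epsilon> \<psi>))"
proof -
  interpret local_solution_family \<alpha> \<epsilon> R \<psi> by fact
  have "\<alpha> > 0" using assms(1) by simp
  then show ?thesis
    using Wu_tilde_negatively_invariant orbit_Wu_tilde_tendsto_0 backward_orbit_in_Wu_tilde
    by blast
qed

end
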